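(* Let $p,q\in[0,1]$, let $m\ge1$ be an integer and $T=4m$. Consider the two-state discrete time Markov chain on $\{-1,+1\}$ with $T$-periodic transition matrices $P_t$ described in the context (the synchronised case). Assume that for each $t\in\{0,\ldots,T-1\}$ the limit $\overline{\nu}(t)=\lim_{N\to\infty}\nu(NT+t)$ exists and does not depend on the initial probability vector $\nu(0)$. Then $$\overline{\nu}(t)=\frac12\begin{pmatrix}1\\1\end{pmatrix}\qquad\text{for all } t\in\{0,1,\ldots,T-1\}.$$
   Context: The chain $Y_t\in\{-1,+1\}$, $t\in\{0,1,2,\ldots\}$, has state probabilities $\nu_-(t)=P(Y_t=-1)$, $\nu_+(t)=P(Y_t=+1)$, $\nu(t)=(\nu_-(t),\nu_+(t))^\dagger$ (with $\dagger$ denoting transpose), so $\nu_-(t)+\nu_+(t)=1$. They evolve by $\nu(t+1)=P_t^\dagger\nu(t)$ from an arbitrary initial probability vector $\nu(0)$. The transition matrices are $T$-periodic: with $n=t\bmod T$, $$P_t=\begin{pmatrix}1-p&p\\ p&1-p\end{pmatrix}\ \text{if } n\in\{0,\ldots,m-1\}\cup\{2m,\ldots,3m-1\},$$ $$P_t=\begin{pmatrix}1-q&q\\ q&1-q\end{pmatrix}\ \text{if } n\in\{m,\ldots,2m-1\}\cup\{3m,\ldots,4m-1\}.$$ The invariant measure is $\overline{\nu}(n):=\lim_{N\to\infty}\nu(NT+n)$. *)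

theory Defs
  imports "HOL-Analysis.Analysis"
begin

text \<open>
  Vectors and matrices over the state space \<open>{-1, +1}\<close> are indexed by the type \<open>2\<close>:
  component \<open>1\<close> belongs to the state \<open>-1\<close> and component \<open>2\<close> to the state \<open>+1\<close>, so that
  \<open>vector [a, b]\<close> is the vector with entry \<open>a\<close> at \<open>-1\<close> and entry \<open>b\<close> at \<open>+1\<close>.
\<close>

definition prob_vector :: "real ^ 'n \<Rightarrow> bool" where
  "prob_vector x \<longleftrightarrow> (\<forall>i. 0 \<le> x $ i) \<and> (\<Sum>i\<in>UNIV. x $ i) = 1"

definition flip_matrix :: "real \<Rightarrow> real ^ 2 ^ 2" where
  "flip_matrix r = vector [vector [1 - r, r], vector [r, 1 - r]]"

text \<open>
  For \<open>m \<ge> 1\<close>, the residues \<open>n < 4 * m\<close> not in the set below are exactly those in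
  \<open>{m..<2 * m} \<union> {3 * m..<4 * m}\<close>.
\<close>

definition trans_matrix :: "real \<Rightarrow> real \<Rightarrow> nat \<Rightarrow> nat \<Rightarrow> real ^ 2 ^ 2" where
  "trans_matrix p q m t =
     (if t mod (4 * m) \<in> {0..<m} \<union> {2 * m..<3 * m} then flip_matrix p else flip_matrix q)"

text \<open>The state probabilities \<open>(P(Y_t = -1), P(Y_t = +1))\<close> of the chain with initial law \<open>\<nu>0\<close>.\<close>

primrec state_probs :: "real \<Rightarrow> real \<Rightarrow> nat \<Rightarrow> real ^ 2 \<Rightarrow> nat \<Rightarrow> real ^ 2" where
  "state_probs p q m \<nu>0 0 = \<nu>0"
| "state_probs p q m \<nu>0 (Suc t) = transpose (trans_matrix p q m t) *v state_probs p q m \<nu>0 t"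

end

theory Submission
  imports Defs
begin

text \<open>
  Every transition matrix of the chain is doubly stochastic, so the uniform law is a fixed point of
  each single step. The chain started in the uniform law
  therefore stays there, and its limits along every residue class are the uniform law. Since the
  limit does not depend on the initial law, evaluating it at this one start determines it.
\<close>

lemma prob_vector_uniform: "prob_vector ((1 / 2) *\<^sub>R vector [1, 1] :: real ^ 2)"
  by (simp add: prob_vector_def forall_2 UNIV_2)

text \<open>
  The columns of a flip matrix sum to one, as its rows do: under the uniform law, each state
  loses to the other exactly the mass that it receives from it.
\<close>

lemma transpose_flip_matrix_uniform:
  "transpose (flip_matrix r) *v ((1 / 2) *\<^sub>R vector [1, 1]) = (1 / 2) *\<^sub>R vector [1, 1]"
  by (simp add: vec_eq_iff forall_2 matrix_vector_mult_def sum_2 transpose_def flip_matrix_def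
      field_simps)

lemma state_probs_uniform:
  "state_probs p q m ((1 / 2) *\<^sub>R vector [1, 1]) t = (1 / 2) *\<^sub>R vector [1, 1]"
proof (induction t)
  case (Suc t)
  then show ?case
    by (simp only: state_probs.simps trans_matrix_def transpose_flip_matrix_uniform split: if_split)
      simp
qed simp

theorem corollary3p4:
  fixes p q :: real and m T :: nat and \<nu>bar :: "nat \<Rightarrow> real ^ 2"
  assumes "p \<in> {0..1}" and "q \<in> {0..1}" and "m \<ge> 1" and "T = 4 * m"
    and "\<And>t \<nu>0. t \<in> {0..<T} \<Longrightarrow> prob_vector \<nu>0 \<Longrightarrow>
           (\<lambda>N. state_probs p q m \<nu>0 (N * T + t)) \<longlonglongrightarrow> \<nu>bar t"
  shows "\<forall>t\<in>{0..<T}. \<nu>bar t = (1 / 2) *\<^sub>R vector [1, 1]"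
proof
  fix t assume "t \<in> {0..<T}"
  from assms(5)[OF this prob_vector_uniform]
  have "(\<lambda>N::nat. (1 / 2) *\<^sub>R vector [1, 1] :: real ^ 2) \<longlonglongrightarrow> \<nu>bar t"
    by (simp only: state_probs_uniform)
  then show "\<nu>bar t = (1 / 2) *\<^sub>R vector [1, 1]"
    using LIMSEQ_unique tendsto_const by blast
qed

end
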